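(* Let $G$ be an edge-colored graph of order $n\geq 3$. If $\delta^c(G)>\frac{3n-3}{4}$, then each vertex of $G$ is contained in a rainbow triangle.
   Context: All graphs are finite, simple and undirected. An edge-colored graph is a graph $G$ together with an arbitrary mapping $c:E(G)\to\mathbb{N}$ (not required to be a proper coloring). The order of $G$ is $|V(G)|$. The color-degree $d^c_G(v)=d^c(v)$ of a vertex $v$ is the number of distinct colors on the edges incident to $v$, and $\delta^c(G)=\min\{d^c_G(v):v\in V(G)\}$ is the minimum color-degree of $G$. A subgraph of $G$ is rainbow if its edges have pairwise distinct colors. *)

theory Defs
  imports Complex_Main
begin

text \<open>Finite simple undirected graphs, with edges as two-element sets of vertices.\<close>

locale simple_graph =
  fixes V :: "'a set" and E :: "'a set set"
  assumes finite_vertices: "finite V"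
    and edges_wf: "e \<in> E \<Longrightarrow> e \<subseteq> V \<and> card e = 2"

definition is_subgraph :: "'a set \<Rightarrow> 'a set set \<Rightarrow> 'a set \<Rightarrow> 'a set set \<Rightarrow> bool" where
  "is_subgraph W F V E \<longleftrightarrow> simple_graph W F \<and> W \<subseteq> V \<and> F \<subseteq> E"

definition is_triangle :: "'a set \<Rightarrow> 'a set set \<Rightarrow> bool" where
  "is_triangle W F \<longleftrightarrow> card W = 3 \<and> F = {e. e \<subseteq> W \<and> card e = 2}"

text \<open>
  An edge colouring is a total function \<open>c\<close> on sets of vertices. Only its values on the
  edge set are ever used, so it stands for an arbitrary map from \<open>E\<close> to the naturals.
\<close>

definition color_degree :: "'a set set \<Rightarrow> ('a set \<Rightarrow> nat) \<Rightarrow> 'a \<Rightarrow> nat" where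
  "color_degree E c v = card (c ` {e \<in> E. v \<in> e})"

text \<open>As usual for \<^const>\<open>Min\<close>, this is meaningful only for finite nonempty \<open>V\<close>.\<close>

definition min_color_degree :: "'a set \<Rightarrow> 'a set set \<Rightarrow> ('a set \<Rightarrow> nat) \<Rightarrow> nat" where
  "min_color_degree V E c = Min (color_degree E c ` V)"

definition rainbow :: "('a set \<Rightarrow> nat) \<Rightarrow> 'a set set \<Rightarrow> bool" where
  "rainbow c F \<longleftrightarrow> inj_on c F"

end

theory Submission
  imports Defs
begin

text \<open>
  Let \<open>d\<close> be a lower bound on the colour degrees, and suppose that \<open>v\<close> lies in no rainbow
  triangle. Choose a set \<open>T\<close> of neighbours of \<open>v\<close>, one for each colour at \<open>v\<close>, so that
  \<open>k = card T\<close> is the colour degree of \<open>v\<close>. An edge between two vertices \<open>x\<close>, \<open>y\<close> of \<open>T\<close>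
  closes a triangle at \<open>v\<close> whose other two colours differ, so it has the colour of \<open>vx\<close> or
  that of \<open>vy\<close>. Orient it towards \<open>y\<close> in the second case and towards \<open>x\<close> in the first. All
  edges of \<open>T\<close> entering \<open>x\<close> have the colour of \<open>vx\<close>, hence besides that one colour \<open>x\<close> sees at
  most one colour per outgoing edge and one per vertex outside \<open>T \<union> {v}\<close>
  (\<open>color_degree_le_out_neighbours\<close>). Some \<open>x \<in> T\<close> has at most \<open>(k - 1) / 2\<close> outgoing edges
  (\<open>ex_few_out_neighbours\<close>), so
  \<open>d \<le> 1 + (k - 1) / 2 + (n - 1 - k) = n - (k + 1) / 2 \<le> n - (d + 1) / 2\<close>, where \<open>n = card V\<close>;
  that is, \<open>3 d \<le> 2 n - 1\<close>. Colour degrees of at least \<open>2 n / 3\<close> therefore force a rainbow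
  triangle at every vertex, and an integer larger than \<open>3 (n - 1) / 4\<close> is at least \<open>2 n / 3\<close> as
  soon as \<open>n \<ge> 3\<close>.
\<close>

text \<open>
  The average out-degree of an oriented graph on \<open>k\<close> vertices is at most \<open>(k - 1) / 2\<close>: the
  arcs, the reversed arcs and the diagonal are disjoint parts of \<open>T \<times> T\<close>.
\<close>

lemma ex_few_out_neighbours:
  assumes fin: "finite T" and "T \<noteq> {}"
    and asym: "\<And>x y. x \<in> T \<Longrightarrow> y \<in> T \<Longrightarrow> R x y \<Longrightarrow> \<not> R y x"
  shows "\<exists>x\<in>T. 2 * card {y \<in> T. R x y} < card T"
proof (rule ccontr)
  assume "\<not> ?thesis"
  then have many: "card T \<le> 2 * card {y \<in> T. R x y}" if "x \<in> T" for x
    using that by (meson not_less)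
  define S where "S = (SIGMA x:T. {y \<in> T. R x y})"
  have finS: "finite S"
    unfolding S_def using fin by auto
  have "card T * card T \<le> (\<Sum>x\<in>T. 2 * card {y \<in> T. R x y})"
    using sum_bounded_below[of T "card T", OF many] by simp
  also have "\<dots> = 2 * card S"
    unfolding S_def using fin by (simp add: sum_distrib_left)
  finally have lower: "card T * card T \<le> 2 * card S" .
  have "S \<inter> S\<inverse> = {}" "(S \<union> S\<inverse>) \<inter> Id_on T = {}"
    unfolding S_def using asym by auto
  then have "card (S \<union> S\<inverse> \<union> Id_on T) = card S + card (S\<inverse>) + card (Id_on T)"
    using finS fin by (simp add: card_Un_disjoint Id_on_def)
  moreover have "card (Id_on T) = card T"
  proof -
    have "Id_on T = (\<lambda>x. (x, x)) ` T" by auto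
    then show ?thesis by (simp add: card_image inj_on_def)
  qed
  moreover have "card (S \<union> S\<inverse> \<union> Id_on T) \<le> card (T \<times> T)"
    by (rule card_mono) (use fin in \<open>auto simp: S_def\<close>)
  ultimately have "2 * card S + card T \<le> card T * card T"
    by (simp add: card_cartesian_product)
  with lower have "card T = 0" by linarith
  with assms(1,2) show False by simp
qed

context simple_graph
begin

lemma edge_endpoints:
  assumes "{x, y} \<in> E"
  shows "x \<in> V" "y \<in> V" "x \<noteq> y"
  using edges_wf[OF assms] by (auto simp: card_insert_if split: if_splits)

lemma edges_at: "{e \<in> E. x \<in> e} = (\<lambda>y. {x, y}) ` {y. {x, y} \<in> E}"
proof -
  have "\<exists>y. e = {x, y}" if "e \<in> E" "x \<in> e" for e
  proof -
    from edges_wf[OF that(1)] obtain a b where "e = {a, b}"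
      by (auto simp: card_2_iff)
    with that(2) show ?thesis by (auto simp: insert_commute)
  qed
  then show ?thesis by blast
qed

lemma triangle_subgraph:
  assumes "{v, x} \<in> E" "{v, y} \<in> E" "{x, y} \<in> E"
    and cols: "c {v, x} \<noteq> c {v, y}" "c {x, y} \<noteq> c {v, x}" "c {x, y} \<noteq> c {v, y}"
  shows "\<exists>W F. is_subgraph W F V E \<and> is_triangle W F \<and> rainbow c F \<and> v \<in> W"
proof -
  let ?W = "{v, x, y}" and ?F = "{{v, x}, {v, y}, {x, y}}"
  note ends = edge_endpoints[OF assms(1)] edge_endpoints[OF assms(2)] edge_endpoints[OF assms(3)]
  have F: "?F = {e. e \<subseteq> ?W \<and> card e = 2}"
    using ends by (auto simp: card_2_iff doubleton_eq_iff)
  have "is_subgraph ?W ?F V E"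
    unfolding is_subgraph_def simple_graph_def using ends assms(1-3) by auto
  moreover have "is_triangle ?W ?F"
    unfolding is_triangle_def using ends F by auto
  moreover have "rainbow c ?F"
    unfolding rainbow_def inj_on_def using cols by auto
  ultimately show ?thesis by blast
qed

lemma ex_neighbour_transversal:
  obtains T where "\<And>x. x \<in> T \<Longrightarrow> {v, x} \<in> E" "inj_on (\<lambda>x. c {v, x}) T"
    "card T = color_degree E c v"
proof -
  have "c ` {e \<in> E. v \<in> e} \<subseteq> (\<lambda>x. c {v, x}) ` {x. {v, x} \<in> E}"
    unfolding edges_at by blast
  then obtain T where "T \<subseteq> {x. {v, x} \<in> E}" "inj_on (\<lambda>x. c {v, x}) T"
    "c ` {e \<in> E. v \<in> e} = (\<lambda>x. c {v, x}) ` T"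
    by (auto simp: subset_image_inj)
  with that[of T] show thesis
    by (auto simp: color_degree_def card_image)
qed

text \<open>
  Hypothesis \<open>dichotomy\<close> is what the absence of rainbow triangles at \<open>v\<close> says about the edges
  at \<open>x\<close>. The edge to \<open>v\<close> and those entering \<open>x\<close> from \<open>T\<close> share a single colour, which gives
  the summand 1.
\<close>

lemma color_degree_le_out_neighbours:
  assumes T: "\<And>z. z \<in> T \<Longrightarrow> {v, z} \<in> E" and "x \<in> T"
    and dichotomy: "\<And>y. y \<in> T \<Longrightarrow> {x, y} \<in> E \<Longrightarrow> c {x, y} = c {v, x} \<or> c {x, y} = c {v, y}"
  shows "color_degree E c x + card T
    \<le> card {y \<in> T. {x, y} \<in> E \<and> c {x, y} = c {v, y}} + card V"
proof -
  let ?out = "{y \<in> T. {x, y} \<in> E \<and> c {x, y} = c {v, y}}"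
  let ?rest = "V - insert v T"
  have sub: "insert v T \<subseteq> V" and "v \<notin> T"
    using edge_endpoints T \<open>x \<in> T\<close> by blast+
  then have finT: "finite T"
    using finite_vertices by (meson finite_subset insert_subset)
  have "c ` {e \<in> E. x \<in> e} \<subseteq> insert (c {v, x}) ((\<lambda>y. c {x, y}) ` (?out \<union> ?rest))"
  proof
    fix a assume "a \<in> c ` {e \<in> E. x \<in> e}"
    then obtain y where y: "{x, y} \<in> E" "a = c {x, y}"
      unfolding edges_at by blast
    consider "y = v" | "y \<in> T" | "y \<in> ?rest"
      using edge_endpoints[OF y(1)] by blast
    then show "a \<in> insert (c {v, x}) ((\<lambda>y. c {x, y}) ` (?out \<union> ?rest))"
    proof cases
      case 1
      with y show ?thesis by (simp add: insert_commute)
    next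
      case 2
      with y dichotomy show ?thesis by blast
    next
      case 3
      with y show ?thesis by blast
    qed
  qed
  then have "color_degree E c x \<le> card (insert (c {v, x}) ((\<lambda>y. c {x, y}) ` (?out \<union> ?rest)))"
    unfolding color_degree_def using finT finite_vertices by (intro card_mono) auto
  also have "\<dots> \<le> Suc (card ((\<lambda>y. c {x, y}) ` (?out \<union> ?rest)))"
    using finT finite_vertices by (simp add: card_insert_if)
  also have "\<dots> \<le> Suc (card (?out \<union> ?rest))"
    using finT finite_vertices by (simp add: card_image_le)
  also have "\<dots> \<le> Suc (card ?out + card ?rest)"
    using card_Un_le[of ?out ?rest] by linarith
  finally have "color_degree E c x \<le> Suc (card ?out + card ?rest)" .
  moreover have "card ?rest + Suc (card T) = card V"
    using card_Diff_subset[of "insert v T" V] card_mono[OF finite_vertices sub] sub finT \<open>v \<notin> T\<close>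
    by simp
  ultimately show ?thesis by linarith
qed

theorem rainbow_triangle_if_color_degree_ge_two_thirds:
  assumes "v \<in> V"
    and deg: "\<And>x. x \<in> V \<Longrightarrow> d \<le> color_degree E c x"
    and large: "2 * card V \<le> 3 * d"
  shows "\<exists>W F. is_subgraph W F V E \<and> is_triangle W F \<and> rainbow c F \<and> v \<in> W"
proof (rule ccontr)
  assume none: "\<not> ?thesis"
  obtain T where T: "\<And>x. x \<in> T \<Longrightarrow> {v, x} \<in> E" and inj: "inj_on (\<lambda>x. c {v, x}) T"
    and cardT: "card T = color_degree E c v"
    by (rule ex_neighbour_transversal[where v = v and c = c]) blast
  have "0 < card V"
    using \<open>v \<in> V\<close> finite_vertices by (auto simp: card_gt_0_iff)
  with large deg[OF \<open>v \<in> V\<close>] cardT have "0 < card T" by linarith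
  then have finT: "finite T" and "T \<noteq> {}" by (auto simp: card_gt_0_iff)
  define R where "R x y \<longleftrightarrow> {x, y} \<in> E \<and> c {x, y} = c {v, y}" for x y
  have dichotomy: "c {x, y} = c {v, x} \<or> c {x, y} = c {v, y}"
    if "x \<in> T" "y \<in> T" "{x, y} \<in> E" for x y
  proof -
    have "c {v, x} \<noteq> c {v, y}"
      using inj edge_endpoints(3)[OF that(3)] that(1,2) by (auto dest: inj_onD)
    then show ?thesis
      using none triangle_subgraph[OF T[OF that(1)] T[OF that(2)] that(3)] by blast
  qed
  have asym: "\<not> R y x" if "x \<in> T" "y \<in> T" "R x y" for x y
  proof
    assume "R y x"
    with \<open>R x y\<close> have "{x, y} \<in> E" "c {v, x} = c {v, y}"
      by (simp_all add: R_def insert_commute[of y])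
    with that(1,2) inj edge_endpoints(3) show False by (blast dest: inj_onD)
  qed
  obtain x where x: "x \<in> T" "2 * card {y \<in> T. R x y} < card T"
    using ex_few_out_neighbours[OF finT \<open>T \<noteq> {}\<close>, of R] asym by blast
  have "color_degree E c x + card T \<le> card {y \<in> T. R x y} + card V"
    unfolding R_def using color_degree_le_out_neighbours[OF T x(1)] dichotomy[OF x(1)] by blast
  moreover have "d \<le> color_degree E c x"
    using deg edge_endpoints T x(1) by blast
  ultimately show False
    using x(2) large deg[OF \<open>v \<in> V\<close>] cardT by linarith
qed

end

theorem theorem1p4:
  fixes V :: "'a set" and E :: "'a set set" and c :: "'a set \<Rightarrow> nat" and n :: nat
  assumes "simple_graph V E"
    and "card V = n" and "n \<ge> 3"
    and "real (min_color_degree V E c) > (3 * real n - 3) / 4"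
  shows "\<forall>v\<in>V. \<exists>W F. is_subgraph W F V E \<and> is_triangle W F \<and> rainbow c F \<and> v \<in> W"
proof
  fix v assume "v \<in> V"
  interpret simple_graph V E by fact
  have deg: "min_color_degree V E c \<le> color_degree E c x" if "x \<in> V" for x
    unfolding min_color_degree_def using that finite_vertices by simp
  have "3 * n < 4 * min_color_degree V E c + 3"
    using assms(4) by (simp add: field_simps flip: of_nat_less_iff[where 'a = real])
  \<comment> \<open>For \<open>n < 9\<close> the number \<open>3 (n - 1) / 4\<close> is below \<open>2 n / 3\<close>, and the integrality of colour
    degrees closes the gap.\<close>
  then have "2 * n \<le> 3 * min_color_degree V E c"
    using assms(3) by presburger
  then have "2 * card V \<le> 3 * min_color_degree V E c"
    using assms(2) by simp
  with \<open>v \<in> V\<close> deg show "\<exists>W F. is_subgraph W F V E \<and> is_triangle W F \<and> rainbow c F \<and> v \<in> W"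
    by (rule rainbow_triangle_if_color_degree_ge_two_thirds)
qed

end
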